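(* Let $(W,S)$ be an affine Coxeter system with underlying finite Weyl group $W_0$ and positive roots $\Phi^+$. The generating function $\Phi^+(q)=\sum_{\beta\in\Phi^+}q^{\operatorname{dp}(\beta)}$ of the depth of positive roots is of the form $$\Phi^+(q)=\frac{P(q)}{1-q^M},$$ where $M=\operatorname{lcm}(M_{\mathcal O}+1\mid\mathcal O\text{ a }W_0\text{-orbit in }\Phi_0)$, with $M_{\mathcal O}=\max\{\operatorname{dp}(\beta)\mid\beta\in\Sigma_{\mathcal O}\}$, and $P(q)$ is a palindromic polynomial.
   Context: Affine setting: $\Phi_0$ is a reduced irreducible crystallographic root system of a finite Weyl group $(W_0,S_0)$ in a Euclidean space $(V_0,B_0)$, with simple roots $\Delta_0=\{\alpha_s\mid s\in S_0\}$, positive roots $\Phi_0^+$ and highest root $\omega$. $V=V_0\oplus\mathbb R\delta$, and $B$ is the extension of $B_0$ to $V$ with radical $\mathbb R\delta$. For $\beta$ with $B(\beta,\beta)\neq 0$, $s_\beta(v)=v-2\frac{B(v,\beta)}{B(\beta,\beta)}\beta$. $\Phi=\{\alpha+k\delta\mid\alpha\in\Phi_0,k\in\mathbb Z\}$, simple system $\Delta=\Delta_0\cup\{\delta-\omega\}$, $S=S_0\cup\{s_{\delta-\omega}\}$, $W=\langle S\rangle$ the affine Weyl group, with length function $\ell$. Positive roots: $\Phi^+=\{k\delta+\alpha,(k+1)\delta-\alpha\mid\alpha\in\Phi_0^+,k\in\mathbb N\}$, $\mathbb N=\{0,1,2,\dots\}$. Depth: $\operatorname{dp}(\beta)=\min\{\ell(w)\mid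 w\in W,w(\beta)\in\Delta\}$ for $\beta\in\Phi^+$. For a $W_0$-orbit $\mathcal O\subseteq\Phi_0$ (there are one or two), $\mathcal O^+=\mathcal O\cap\Phi_0^+$ and $\Sigma_{\mathcal O}=\mathcal O^+\sqcup(\delta-\mathcal O^+)$. A polynomial $P$ of degree $d$ is palindromic if $q^dP(q^{-1})=P(q)$. *)

theory Defs
  imports "HOL-Analysis.Analysis" "HOL-Computational_Algebra.Computational_Algebra"
begin

section \<open>Reflections and reflection groups\<close>

definition reflection :: "('v::real_vector \<Rightarrow> 'v \<Rightarrow> real) \<Rightarrow> 'v \<Rightarrow> 'v \<Rightarrow> 'v" where
  "reflection B \<beta> v = v - (2 * B v \<beta> / B \<beta> \<beta>) *\<^sub>R \<beta>"

definition word_prod :: "('v \<Rightarrow> 'v) list \<Rightarrow> 'v \<Rightarrow> 'v" where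
  "word_prod ws = foldr (\<circ>) ws id"

text \<open>
  The group generated by a set \<open>S\<close> of maps. This definition is only used for sets of
  reflections; these are involutions, so inverses of generators need not be adjoined.
\<close>

definition generated_by :: "('v \<Rightarrow> 'v) set \<Rightarrow> ('v \<Rightarrow> 'v) set" where
  "generated_by S = {word_prod ws | ws. set ws \<subseteq> S}"

definition word_length :: "('v \<Rightarrow> 'v) set \<Rightarrow> ('v \<Rightarrow> 'v) \<Rightarrow> nat" where
  "word_length S w = (LEAST n. \<exists>ws. set ws \<subseteq> S \<and> length ws = n \<and> word_prod ws = w)"


section \<open>Finite root systems\<close>

text \<open>
  The Euclidean space \<open>(V\<^sub>0, B\<^sub>0)\<close> is a type of class \<open>euclidean_space\<close> with its inner product.
\<close>

definition root_system :: "'a::euclidean_space set \<Rightarrow> bool" where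
  "root_system \<Phi>0 \<longleftrightarrow>
     finite \<Phi>0 \<and> 0 \<notin> \<Phi>0 \<and> span \<Phi>0 = UNIV \<and>
     (\<forall>\<alpha>\<in>\<Phi>0. reflection (\<bullet>) \<alpha> ` \<Phi>0 = \<Phi>0)"

definition crystallographic :: "'a::euclidean_space set \<Rightarrow> bool" where
  "crystallographic \<Phi>0 \<longleftrightarrow> (\<forall>\<alpha>\<in>\<Phi>0. \<forall>\<beta>\<in>\<Phi>0. 2 * (\<alpha> \<bullet> \<beta>) / (\<beta> \<bullet> \<beta>) \<in> \<int>)"

definition reduced_roots :: "'a::euclidean_space set \<Rightarrow> bool" where
  "reduced_roots \<Phi>0 \<longleftrightarrow> (\<forall>\<alpha>\<in>\<Phi>0. \<forall>c. c *\<^sub>R \<alpha> \<in> \<Phi>0 \<longrightarrow> c = 1 \<or> c = - 1)"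

definition irreducible_roots :: "'a::euclidean_space set \<Rightarrow> bool" where
  "irreducible_roots \<Phi>0 \<longleftrightarrow>
     \<Phi>0 \<noteq> {} \<and>
     \<not> (\<exists>A B. A \<noteq> {} \<and> B \<noteq> {} \<and> A \<union> B = \<Phi>0 \<and> A \<inter> B = {} \<and> (\<forall>\<alpha>\<in>A. \<forall>\<beta>\<in>B. \<alpha> \<bullet> \<beta> = 0))"

definition nonneg_span :: "'a::real_vector set \<Rightarrow> 'a set" where
  "nonneg_span D = {(\<Sum>\<alpha>\<in>D. c \<alpha> *\<^sub>R \<alpha>) | c. \<forall>\<alpha>\<in>D. 0 \<le> c \<alpha>}"

definition simple_system :: "'a::euclidean_space set \<Rightarrow> 'a set \<Rightarrow> bool" where
  "simple_system \<Phi>0 \<Delta>0 \<longleftrightarrow>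
     \<Delta>0 \<subseteq> \<Phi>0 \<and> independent \<Delta>0 \<and>
     (\<forall>\<alpha>\<in>\<Phi>0. \<alpha> \<in> nonneg_span \<Delta>0 \<or> - \<alpha> \<in> nonneg_span \<Delta>0)"

definition positive_roots :: "'a::euclidean_space set \<Rightarrow> 'a set \<Rightarrow> 'a set" where
  "positive_roots \<Phi>0 \<Delta>0 = \<Phi>0 \<inter> nonneg_span \<Delta>0"

text \<open>The highest root is the greatest root for the order given by the simple system.\<close>

definition highest_root :: "'a::euclidean_space set \<Rightarrow> 'a set \<Rightarrow> 'a \<Rightarrow> bool" where
  "highest_root \<Phi>0 \<Delta>0 \<omega> \<longleftrightarrow> \<omega> \<in> \<Phi>0 \<and> (\<forall>\<alpha>\<in>\<Phi>0. \<omega> - \<alpha> \<in> nonneg_span \<Delta>0)"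

definition finite_weyl_group :: "'a::euclidean_space set \<Rightarrow> ('a \<Rightarrow> 'a) set" where
  "finite_weyl_group \<Delta>0 = generated_by (reflection (\<bullet>) ` \<Delta>0)"

definition root_orbits :: "'a::euclidean_space set \<Rightarrow> 'a set \<Rightarrow> 'a set set" where
  "root_orbits \<Phi>0 \<Delta>0 = (\<lambda>\<alpha>. {w \<alpha> | w. w \<in> finite_weyl_group \<Delta>0}) ` \<Phi>0"


section \<open>Affine root systems\<close>

text \<open>
  \<open>V = V\<^sub>0 \<oplus> \<real>\<delta>\<close> is the product type \<open>'a \<times> real\<close>. The form on \<open>V\<close> is
  \<^term>\<open>affine_form\<close>, whose radical is spanned by \<open>\<delta>\<close>; it is not the inner product that
  the library puts on the product type.
\<close>

definition delta :: "'a::euclidean_space \<times> real" where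
  "delta = (0, 1)"

definition emb :: "'a::euclidean_space \<Rightarrow> 'a \<times> real" where
  "emb v = (v, 0)"

definition affine_form :: "'a::euclidean_space \<times> real \<Rightarrow> 'a \<times> real \<Rightarrow> real" where
  "affine_form x y = fst x \<bullet> fst y"

definition affine_simple_roots :: "'a::euclidean_space set \<Rightarrow> 'a \<Rightarrow> ('a \<times> real) set" where
  "affine_simple_roots \<Delta>0 \<omega> = emb ` \<Delta>0 \<union> {delta - emb \<omega>}"

definition affine_positive_roots :: "'a::euclidean_space set \<Rightarrow> 'a set \<Rightarrow> ('a \<times> real) set" where
  "affine_positive_roots \<Phi>0 \<Delta>0 =
     {real k *\<^sub>R delta + emb \<alpha> | k \<alpha>. \<alpha> \<in> positive_roots \<Phi>0 \<Delta>0} \<union>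
     {real (k + 1) *\<^sub>R delta - emb \<alpha> | k \<alpha>. \<alpha> \<in> positive_roots \<Phi>0 \<Delta>0}"

definition affine_simple_reflections ::
    "'a::euclidean_space set \<Rightarrow> 'a \<Rightarrow> ('a \<times> real \<Rightarrow> 'a \<times> real) set" where
  "affine_simple_reflections \<Delta>0 \<omega> = reflection affine_form ` affine_simple_roots \<Delta>0 \<omega>"

definition affine_weyl_group ::
    "'a::euclidean_space set \<Rightarrow> 'a \<Rightarrow> ('a \<times> real \<Rightarrow> 'a \<times> real) set" where
  "affine_weyl_group \<Delta>0 \<omega> = generated_by (affine_simple_reflections \<Delta>0 \<omega>)"

definition affine_length ::
    "'a::euclidean_space set \<Rightarrow> 'a \<Rightarrow> ('a \<times> real \<Rightarrow> 'a \<times> real) \<Rightarrow> nat" where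
  "affine_length \<Delta>0 \<omega> = word_length (affine_simple_reflections \<Delta>0 \<omega>)"

definition depth :: "'a::euclidean_space set \<Rightarrow> 'a \<Rightarrow> 'a \<times> real \<Rightarrow> nat" where
  "depth \<Delta>0 \<omega> \<beta> =
     (LEAST n. \<exists>w \<in> affine_weyl_group \<Delta>0 \<omega>.
        w \<beta> \<in> affine_simple_roots \<Delta>0 \<omega> \<and> affine_length \<Delta>0 \<omega> w = n)"

definition roots_of_depth ::
    "'a::euclidean_space set \<Rightarrow> 'a set \<Rightarrow> 'a \<Rightarrow> nat \<Rightarrow> ('a \<times> real) set" where
  "roots_of_depth \<Phi>0 \<Delta>0 \<omega> n = {\<beta> \<in> affine_positive_roots \<Phi>0 \<Delta>0. depth \<Delta>0 \<omega> \<beta> = n}"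

text \<open>
  \<open>\<Phi>\<^sup>+(q) = (\<Sum>\<beta>\<in>\<Phi>\<^sup>+. q ^ depth \<beta>)\<close> as a formal power series. It is meaningful only when every
  set \<^term>\<open>roots_of_depth \<Phi>0 \<Delta>0 \<omega> n\<close> is finite, since \<^const>\<open>card\<close> is \<open>0\<close> on infinite sets.
\<close>

definition depth_series :: "'a::euclidean_space set \<Rightarrow> 'a set \<Rightarrow> 'a \<Rightarrow> rat fps" where
  "depth_series \<Phi>0 \<Delta>0 \<omega> = Abs_fps (\<lambda>n. of_nat (card (roots_of_depth \<Phi>0 \<Delta>0 \<omega> n)))"

definition Sigma_orbit :: "'a::euclidean_space set \<Rightarrow> 'a set \<Rightarrow> 'a set \<Rightarrow> ('a \<times> real) set" where
  "Sigma_orbit \<Phi>0 \<Delta>0 \<O> =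
     emb ` (\<O> \<inter> positive_roots \<Phi>0 \<Delta>0) \<union>
     (\<lambda>\<alpha>. delta - emb \<alpha>) ` (\<O> \<inter> positive_roots \<Phi>0 \<Delta>0)"

definition max_depth :: "'a::euclidean_space set \<Rightarrow> 'a set \<Rightarrow> 'a \<Rightarrow> 'a set \<Rightarrow> nat" where
  "max_depth \<Phi>0 \<Delta>0 \<omega> \<O> = Max (depth \<Delta>0 \<omega> ` Sigma_orbit \<Phi>0 \<Delta>0 \<O>)"

definition period :: "'a::euclidean_space set \<Rightarrow> 'a set \<Rightarrow> 'a \<Rightarrow> nat" where
  "period \<Phi>0 \<Delta>0 \<omega> = Lcm ((\<lambda>\<O>. max_depth \<Phi>0 \<Delta>0 \<omega> \<O> + 1) ` root_orbits \<Phi>0 \<Delta>0)"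

text \<open>
  \<^term>\<open>reflect_poly P\<close> is \<open>q ^ d * P (1 / q)\<close> with \<open>d = degree P\<close>.
\<close>

definition palindromic :: "'b::zero poly \<Rightarrow> bool" where
  "palindromic P \<longleftrightarrow> reflect_poly P = P"

end

theory Submission
  imports Defs
begin

text \<open>
  For a root \<open>\<alpha>\<close> of square length \<open>L\<close>, let \<open>h\<close> be the linear functional with
  \<open>h(b) = min 1 (|b|\<^sup>2 / L)\<close> on simple roots \<open>b\<close>. The function
  \<open>\<alpha> + k\<delta> \<mapsto> k h(\<omega>) + h(\<alpha>) - [\<alpha> > 0]\<close> vanishes on the affine simple roots and drops by exactly
  one under a simple reflection \<open>s\<^sub>\<gamma>\<close> whenever \<open>B(\<beta>, \<gamma>) > 0\<close>; hence it is the depth. It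
  is periodic in \<open>k\<close> with step \<open>N = h(\<omega>)\<close>, which equals \<open>M\<^sub>\<O> + 1\<close> because the orbit \<open>\<O>\<close> of \<open>\<alpha>\<close>
  contains a simple root, and on \<open>\<Sigma>\<^sub>\<O>\<close> the depths of \<open>\<alpha>\<close> and \<open>\<delta> - \<alpha>\<close> add up to \<open>N - 1\<close>.
  The number of roots of depth \<open>n\<close> is therefore periodic in \<open>n\<close> with period \<open>M\<close> and symmetric under
  \<open>n \<mapsto> M - 1 - n\<close>.
\<close>

section \<open>Generating functions of periodic, symmetric counts\<close>

text \<open>Each \<open>a\<close> stands for the arithmetic progression starting at
  \<open>d a\<close> with difference \<open>N a\<close>, and \<open>f n\<close> counts the
  progressions through \<open>n\<close>. Multiplying the series by \<open>1 - fps_X ^ M\<close>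
  leaves one period of \<open>f\<close>; the involution \<open>i\<close> makes that period read the
  same backwards.\<close>

lemma periodic_palindromic_series:
  fixes d N :: "'b \<Rightarrow> nat" and i :: "'b \<Rightarrow> 'b"
  assumes i: "\<And>a. a \<in> A \<Longrightarrow> i a \<in> A" "\<And>a. a \<in> A \<Longrightarrow> i (i a) = a"
    and Ni: "\<And>a. a \<in> A \<Longrightarrow> N (i a) = N a"
    and di: "\<And>a. a \<in> A \<Longrightarrow> d a + d (i a) + 1 = N a"
    and dvd: "\<And>a. a \<in> A \<Longrightarrow> N a dvd M"
    and "finite A" "M > 0" and zero: "\<exists>a\<in>A. d a = 0"
  defines "f \<equiv> \<lambda>n. card {a \<in> A. n mod N a = d a}"
  shows "\<exists>P::rat poly. palindromic P \<and>
    Abs_fps (\<lambda>n. of_nat (f n)) = fps_of_poly P / (1 - fps_X ^ M)"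
proof -
  have periodic: "f (n + M) = f n" for n
  proof -
    have "(n + M) mod N a = n mod N a" if "a \<in> A" for a
      using dvd[OF that] by (metis add_0_right mod_add_right_eq dvd_imp_mod_0)
    then show ?thesis unfolding f_def by (metis (mono_tags, lifting))
  qed
  have refl: "f (M - 1 - n) = f n" if "n < M" for n
  proof -
    \<comment> \<open>As \<open>N a\<close> divides \<open>M\<close>, the map sending
      \<open>n\<close> to \<open>M - 1 - n\<close> reverses residues modulo
      \<open>N a\<close>.\<close>
    have key: "(M - 1 - n) mod N a = N a - 1 - n mod N a" if a: "a \<in> A" for a
    proof -
      have pos: "N a > 0" using di[OF a] by simp
      obtain c where c: "M = N a * c" using dvd[OF a] by (elim dvdE)
      define q r where "q = n div N a" and "r = n mod N a"
      have n: "n = N a * q + r" and r: "r < N a" using pos by (auto simp: q_def r_def)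
      have "q < c" using \<open>n < M\<close> n c by (metis add_lessD1 nat_mult_less_cancel1 pos)
      then obtain e where e: "c = q + e + 1" by (metis add.commute less_imp_Suc_add Suc_eq_plus1)
      have "M - 1 - n = N a * e + (N a - 1 - r)"
        using r unfolding n c e by (simp add: algebra_simps)
      then have "(M - 1 - n) mod N a = (N a - 1 - r) mod N a" by (simp only: mod_mult_self4)
      then show ?thesis using pos unfolding r_def[symmetric] by simp
    qed
    have "bij_betw i {a \<in> A. n mod N a = d a} {a \<in> A. (M - 1 - n) mod N a = d a}"
    proof (rule bij_betw_byWitness[where f' = i])
      show "i ` {a \<in> A. n mod N a = d a} \<subseteq> {a \<in> A. (M - 1 - n) mod N a = d a}"
        using i(1) key Ni di by fastforce
      show "i ` {a \<in> A. (M - 1 - n) mod N a = d a} \<subseteq> {a \<in> A. n mod N a = d a}"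
      proof (clarify, intro conjI)
        fix a assume a: "a \<in> A" "(M - 1 - n) mod N a = d a"
        have "n mod N a < N a" using di[OF a(1)] by simp
        then show "n mod N (i a) = d (i a)"
          using key[OF a(1)] di[OF a(1)] a(2) unfolding Ni[OF a(1)] by linarith
      qed (use i in auto)
    qed (use i in auto)
    then show ?thesis unfolding f_def by (simp add: bij_betw_same_card)
  qed
  define P :: "rat poly" where "P = Abs_poly (\<lambda>n. if n < M then of_nat (f n) else 0)"
  have coeff_P: "coeff P n = (if n < M then of_nat (f n) else 0)" for n
    unfolding P_def by (subst coeff_Abs_poly[of M]) auto
  \<comment> \<open>\<open>palindromic\<close> reflects at the true degree, so the coefficient at
    \<open>M - 1\<close> must not vanish; by symmetry it equals \<open>f 0\<close>.\<close>
  have "f 0 > 0"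
    using zero \<open>finite A\<close> unfolding f_def by (auto simp: card_gt_0_iff)
  then have "coeff P (M - 1) \<noteq> 0" using refl[of 0] \<open>M > 0\<close> by (simp add: coeff_P)
  then have deg: "degree P = M - 1"
    by (intro antisym degree_le le_degree) (auto simp: coeff_P)
  have "palindromic P" unfolding palindromic_def
  proof (rule poly_eqI)
    fix n
    show "coeff (reflect_poly P) n = coeff P n"
      using refl[of n] \<open>M > 0\<close> by (auto simp: coeff_reflect_poly deg coeff_P)
  qed
  let ?F = "Abs_fps (\<lambda>n. of_nat (f n)) :: rat fps"
  let ?U = "1 - fps_X ^ M :: rat fps"
  have "?F * ?U = fps_of_poly P"
  proof (rule fps_ext)
    fix n
    have "f (n - M) = f n" if "n \<ge> M" using periodic[of "n - M"] that by simp
    then show "fps_nth (?F * ?U) n = fps_nth (fps_of_poly P) n"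
      by (auto simp: right_diff_distrib fps_X_power_mult_right_nth coeff_P)
  qed
  moreover have "fps_nth ?U 0 \<noteq> 0" using \<open>M > 0\<close> by simp
  ultimately have "?F = fps_of_poly P / ?U"
    by (metis fps_nonzeroI nonzero_mult_div_cancel_right)
  then show ?thesis using \<open>palindromic P\<close> by blast
qed

section \<open>Finite root systems with a highest root\<close>

locale highest_root_system =
  fixes \<Phi>0 \<Delta>0 :: "'a::euclidean_space set" and \<omega> :: 'a
  assumes root_system: "root_system \<Phi>0" and reduced: "reduced_roots \<Phi>0"
    and crystallographic: "crystallographic \<Phi>0"
    and simple_system: "simple_system \<Phi>0 \<Delta>0" and highest: "highest_root \<Phi>0 \<Delta>0 \<omega>"
begin

abbreviation coef :: "'a \<Rightarrow> 'a \<Rightarrow> real" where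
  "coef \<equiv> representation \<Delta>0"

lemma finite_roots: "finite \<Phi>0" and zero_notin: "0 \<notin> \<Phi>0"
  using root_system by (auto simp: root_system_def)

lemma simple_subset: "\<Delta>0 \<subseteq> \<Phi>0" and indep: "independent \<Delta>0"
  using simple_system by (auto simp: simple_system_def)

lemma finite_simple: "finite \<Delta>0"
  using finite_roots simple_subset finite_subset by blast

lemma reflection_root: "\<alpha> \<in> \<Phi>0 \<Longrightarrow> \<beta> \<in> \<Phi>0 \<Longrightarrow> reflection (\<bullet>) \<alpha> \<beta> \<in> \<Phi>0"
  using root_system by (auto simp: root_system_def)

lemma root_nonzero: "\<alpha> \<in> \<Phi>0 \<Longrightarrow> \<alpha> \<noteq> 0" and root_inner_pos: "\<alpha> \<in> \<Phi>0 \<Longrightarrow> \<alpha> \<bullet> \<alpha> > 0"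
  using zero_notin by auto

lemma inner_self_not_neg [simp]: "\<not> v \<bullet> v < (0::real)" for v :: 'a
  by (simp add: not_less)

lemma uminus_root: "\<alpha> \<in> \<Phi>0 \<Longrightarrow> - \<alpha> \<in> \<Phi>0"
  using reflection_root[of \<alpha> \<alpha>] root_nonzero[of \<alpha>] by (simp add: reflection_def scaleR_2)

lemma span_simple: "v \<in> span \<Delta>0"
proof -
  have nn: "nonneg_span \<Delta>0 \<subseteq> span \<Delta>0"
    unfolding nonneg_span_def by (auto intro: span_sum span_scale span_base)
  have "\<Phi>0 \<subseteq> span \<Delta>0"
  proof
    fix \<alpha> assume "\<alpha> \<in> \<Phi>0"
    then have "\<alpha> \<in> nonneg_span \<Delta>0 \<or> - \<alpha> \<in> nonneg_span \<Delta>0"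
      using simple_system by (auto simp: simple_system_def)
    then show "\<alpha> \<in> span \<Delta>0" using nn span_neg[of "- \<alpha>" \<Delta>0] by auto
  qed
  then have "span \<Phi>0 \<subseteq> span \<Delta>0" by (simp add: span_minimal)
  then show ?thesis using root_system by (auto simp: root_system_def)
qed

lemma coef_simps [simp]:
  "coef (u + v) b = coef u b + coef v b" "coef (u - v) b = coef u b - coef v b"
  "coef (- v) b = - coef v b" "coef (r *\<^sub>R v) b = r * coef v b"
  using representation_add[OF indep span_simple span_simple]
    representation_diff[OF indep span_simple span_simple]
    representation_neg[OF indep span_simple] representation_scale[OF indep span_simple]
  by auto

lemma coef_simple: "b \<in> \<Delta>0 \<Longrightarrow> coef b c = (if b = c then 1 else 0)"
  using representation_basis[OF indep] by simp

lemma coef_expansion: "v = (\<Sum>b\<in>\<Delta>0. coef v b *\<^sub>R b)"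
  using sum_representation_eq[OF indep span_simple finite_simple] by simp

lemma inner_expansion: "v \<bullet> u = (\<Sum>b\<in>\<Delta>0. coef v b * (b \<bullet> u))"
  by (subst coef_expansion[of v]) (simp add: inner_sum_left)

lemma nonneg_span_iff: "v \<in> nonneg_span \<Delta>0 \<longleftrightarrow> (\<forall>b\<in>\<Delta>0. coef v b \<ge> 0)"
proof
  assume "v \<in> nonneg_span \<Delta>0"
  then obtain c where c: "v = (\<Sum>b\<in>\<Delta>0. c b *\<^sub>R b)" "\<forall>b\<in>\<Delta>0. 0 \<le> c b"
    unfolding nonneg_span_def by blast
  have "coef v b = c b" if "b \<in> \<Delta>0" for b
  proof -
    have "coef v b = (\<Sum>a\<in>\<Delta>0. c a * coef a b)"
      unfolding c(1) using representation_sum[OF indep span_simple, of "\<lambda>a. c a *\<^sub>R a" \<Delta>0] by simp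
    also have "\<dots> = (\<Sum>a\<in>\<Delta>0. if a = b then c a else 0)"
      by (rule sum.cong) (auto simp: coef_simple)
    finally show ?thesis using that finite_simple by simp
  qed
  then show "\<forall>b\<in>\<Delta>0. coef v b \<ge> 0" using c by simp
next
  assume "\<forall>b\<in>\<Delta>0. coef v b \<ge> 0"
  then show "v \<in> nonneg_span \<Delta>0" unfolding nonneg_span_def using coef_expansion[of v] by blast
qed

text \<open>Available for all vectors, so that \<open>pos (\<omega> - \<alpha>)\<close> expresses
  the root order.\<close>

abbreviation pos :: "'a \<Rightarrow> bool" where
  "pos v \<equiv> v \<in> nonneg_span \<Delta>0"

lemma pos_or_neg: "\<alpha> \<in> \<Phi>0 \<Longrightarrow> pos \<alpha> \<or> pos (- \<alpha>)"
  using simple_system by (auto simp: simple_system_def)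

lemma not_pos_and_neg: "\<alpha> \<in> \<Phi>0 \<Longrightarrow> pos \<alpha> \<Longrightarrow> \<not> pos (- \<alpha>)"
proof
  assume "\<alpha> \<in> \<Phi>0" "pos \<alpha>" "pos (- \<alpha>)"
  then have "\<forall>b\<in>\<Delta>0. coef \<alpha> b = 0" by (force simp: nonneg_span_iff)
  then have "\<alpha> = 0" using coef_expansion[of \<alpha>] by simp
  then show False using zero_notin \<open>\<alpha> \<in> \<Phi>0\<close> by simp
qed

lemma pos_uminus: "\<alpha> \<in> \<Phi>0 \<Longrightarrow> pos (- \<alpha>) \<longleftrightarrow> \<not> pos \<alpha>"
  using pos_or_neg not_pos_and_neg by blast

lemma pos_simple: "b \<in> \<Delta>0 \<Longrightarrow> pos b"
  by (auto simp: nonneg_span_iff coef_simple)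

lemma highest_mem: "\<omega> \<in> \<Phi>0" and highest_diff: "\<alpha> \<in> \<Phi>0 \<Longrightarrow> pos (\<omega> - \<alpha>)"
  using highest by (auto simp: highest_root_def)

lemma inner_nonneg_of_dominant:
  "(\<And>b. b \<in> \<Delta>0 \<Longrightarrow> b \<bullet> u \<ge> 0) \<Longrightarrow> pos v \<Longrightarrow> v \<bullet> u \<ge> 0"
  unfolding inner_expansion[of v u] by (auto simp: nonneg_span_iff intro!: sum_nonneg)

text \<open>Otherwise reflecting \<open>\<omega>\<close> in \<open>b\<close> would add a positive
  multiple of \<open>b\<close> and give a root that is not below \<open>\<omega>\<close>.\<close>

lemma highest_dominant: "b \<in> \<Delta>0 \<Longrightarrow> b \<bullet> \<omega> \<ge> 0"
proof -
  assume b: "b \<in> \<Delta>0"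
  then have "b \<in> \<Phi>0" using simple_subset by auto
  then have "pos (\<omega> - reflection (\<bullet>) b \<omega>)"
    using highest_diff reflection_root highest_mem by blast
  then have "2 * (\<omega> \<bullet> b) / (b \<bullet> b) \<ge> 0"
    using b by (auto simp: nonneg_span_iff reflection_def coef_simple)
  then show ?thesis using root_inner_pos[OF \<open>b \<in> \<Phi>0\<close>]
    by (simp add: zero_le_divide_iff inner_commute)
qed

lemma pos_inner_highest: "pos v \<Longrightarrow> v \<bullet> \<omega> \<ge> 0"
  using inner_nonneg_of_dominant highest_dominant by blast

lemma pos_highest: "pos \<omega>"
proof (rule ccontr)
  assume "\<not> pos \<omega>"
  then have "pos (- \<omega>)" using pos_or_neg highest_mem by blast
  then show False using pos_inner_highest[of "- \<omega>"] root_inner_pos[OF highest_mem] by simp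
qed

lemma pos_of_inner_highest: "\<alpha> \<in> \<Phi>0 \<Longrightarrow> \<alpha> \<bullet> \<omega> > 0 \<Longrightarrow> pos \<alpha>"
  using pos_or_neg[of \<alpha>] pos_inner_highest[of "- \<alpha>"] by auto

lemma inner_reflection: "\<alpha> \<in> \<Phi>0 \<Longrightarrow> reflection (\<bullet>) \<alpha> v \<bullet> reflection (\<bullet>) \<alpha> v = v \<bullet> v"
  using root_inner_pos[of \<alpha>]
  by (simp add: reflection_def inner_diff_left inner_diff_right inner_commute field_simps)

lemma inner_reflection_self: "\<alpha> \<in> \<Phi>0 \<Longrightarrow> reflection (\<bullet>) \<alpha> v \<bullet> \<alpha> = - (v \<bullet> \<alpha>)"
  using root_inner_pos[of \<alpha>] by (simp add: reflection_def inner_diff_left)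

lemma reflection_self: "\<alpha> \<in> \<Phi>0 \<Longrightarrow> reflection (\<bullet>) \<alpha> \<alpha> = - \<alpha>"
  using root_inner_pos[of \<alpha>] by (simp add: reflection_def scaleR_2)

text \<open>Among the roots as long as \<open>\<alpha>\<close>, one of maximal height,
  \<open>\<gamma>\<close>, is dominant, since a simple reflection cannot raise its height. Pairing
  \<open>\<omega> - \<gamma>\<close> with the dominant vectors \<open>\<gamma>\<close> and
  \<open>\<omega>\<close> gives \<open>\<gamma> \<bullet> \<gamma> \<le> \<omega> \<bullet> \<gamma>
  \<le> \<omega> \<bullet> \<omega>\<close>.\<close>

lemma highest_longest: "\<alpha> \<in> \<Phi>0 \<Longrightarrow> \<alpha> \<bullet> \<alpha> \<le> \<omega> \<bullet> \<omega>"
proof -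
  assume \<alpha>: "\<alpha> \<in> \<Phi>0"
  define R where "R = {\<gamma> \<in> \<Phi>0. \<gamma> \<bullet> \<gamma> = \<alpha> \<bullet> \<alpha>}"
  define ht where "ht v = (\<Sum>b\<in>\<Delta>0. coef v b)" for v
  have R: "finite R" "R \<noteq> {}" using \<alpha> finite_roots by (auto simp: R_def)
  obtain \<gamma> where \<gamma>: "\<gamma> \<in> R" and max: "\<And>\<beta>. \<beta> \<in> R \<Longrightarrow> ht \<beta> \<le> ht \<gamma>"
    using Max_in[of "ht ` R"] Max_ge[of "ht ` R"] R by fastforce
  have dom: "b \<bullet> \<gamma> \<ge> 0" if b: "b \<in> \<Delta>0" for b
  proof -
    have b': "b \<in> \<Phi>0" using b simple_subset by auto
    have "reflection (\<bullet>) b \<gamma> \<in> R"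
      using \<gamma> reflection_root[OF b'] inner_reflection[OF b'] by (simp add: R_def)
    then have "ht (reflection (\<bullet>) b \<gamma>) \<le> ht \<gamma>" by (rule max)
    moreover have "ht (reflection (\<bullet>) b \<gamma>) = ht \<gamma> - 2 * (\<gamma> \<bullet> b) / (b \<bullet> b)"
    proof -
      have "(\<Sum>c\<in>\<Delta>0. r * coef b c) = r" for r
        using b finite_simple by (simp add: coef_simple if_distrib cong: if_cong)
      then show ?thesis by (simp only: ht_def reflection_def coef_simps sum_subtractf)
    qed
    ultimately have "2 * (\<gamma> \<bullet> b) / (b \<bullet> b) \<ge> 0" by simp
    then show ?thesis using root_inner_pos[OF b']
      by (simp add: zero_le_divide_iff inner_commute)
  qed
  have "\<gamma> \<in> \<Phi>0" using \<gamma> by (simp add: R_def)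
  then have "(\<omega> - \<gamma>) \<bullet> \<gamma> \<ge> 0" "(\<omega> - \<gamma>) \<bullet> \<omega> \<ge> 0"
    using inner_nonneg_of_dominant[OF dom] pos_inner_highest highest_diff by blast+
  then have "\<gamma> \<bullet> \<gamma> \<le> \<omega> \<bullet> \<omega>" using inner_commute[of \<gamma> \<omega>] by (simp add: inner_diff_left)
  then show ?thesis using \<gamma> by (simp add: R_def)
qed

lemma not_parallel:
  assumes "\<alpha> \<in> \<Phi>0" "\<beta> \<in> \<Phi>0" "\<alpha> \<noteq> \<beta>" "\<alpha> \<noteq> - \<beta>"
  shows "\<alpha> \<noteq> c *\<^sub>R \<beta>"
proof
  assume "\<alpha> = c *\<^sub>R \<beta>"
  moreover from this have "c = 1 \<or> c = - 1"
    using assms reduced unfolding reduced_roots_def by blast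
  ultimately show False using assms by auto
qed

text \<open>Strict Cauchy-Schwarz for non-parallel roots puts this Cartan integer strictly between 0
  and 2.\<close>

lemma cartan_eq_1:
  assumes "\<alpha> \<in> \<Phi>0" "\<beta> \<in> \<Phi>0" "\<alpha> \<noteq> \<beta>" "\<alpha> \<bullet> \<beta> > 0" "\<alpha> \<bullet> \<alpha> \<le> \<beta> \<bullet> \<beta>"
  shows "2 * (\<alpha> \<bullet> \<beta>) / (\<beta> \<bullet> \<beta>) = 1"
proof -
  have pos: "\<alpha> \<bullet> \<alpha> > 0" "\<beta> \<bullet> \<beta> > 0" using assms root_inner_pos by auto
  obtain n where n: "2 * (\<alpha> \<bullet> \<beta>) / (\<beta> \<bullet> \<beta>) = of_int n"
    using crystallographic assms unfolding crystallographic_def by (metis Ints_cases)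
  \<comment> \<open>\<open>p *\<^sub>R \<beta>\<close> is the orthogonal projection of
    \<open>\<alpha>\<close> onto the line of \<open>\<beta>\<close>; the nonzero remainder makes the
    inequality strict.\<close>
  define p where "p = \<alpha> \<bullet> \<beta> / (\<beta> \<bullet> \<beta>)"
  have ab: "\<alpha> \<bullet> \<beta> = p * (\<beta> \<bullet> \<beta>)" using pos by (simp add: p_def)
  have "\<alpha> \<noteq> - \<beta>" using assms pos by auto
  then have "\<alpha> - p *\<^sub>R \<beta> \<noteq> 0" using not_parallel[of \<alpha> \<beta>] assms by auto
  then have "(\<alpha> - p *\<^sub>R \<beta>) \<bullet> (\<alpha> - p *\<^sub>R \<beta>) > 0" by simp
  moreover have "(\<alpha> - p *\<^sub>R \<beta>) \<bullet> (\<alpha> - p *\<^sub>R \<beta>) = \<alpha> \<bullet> \<alpha> - p * p * (\<beta> \<bullet> \<beta>)"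
    by (simp add: inner_diff_left inner_diff_right inner_commute[of \<beta> \<alpha>] ab)
  ultimately have "p * p * (\<beta> \<bullet> \<beta>) < 1 * (\<beta> \<bullet> \<beta>)" using assms by simp
  then have "p * p < 1" using pos by (simp only: mult_less_cancel_right_pos)
  moreover have "p > 0" using assms pos by (simp add: p_def)
  ultimately have "p < 1" by (metis mult_mono linorder_not_le less_eq_real_def mult_1 zero_le_one)
  moreover have "of_int n = 2 * p" using n by (simp add: p_def)
  ultimately have "0 < n" "n < 2" using \<open>p > 0\<close> by linarith+
  then show ?thesis using n by simp
qed

text \<open>The reflection changes only the coordinate at \<open>b\<close>. If the image were
  negative, all other coordinates of \<open>\<alpha>\<close> would vanish and
  \<open>\<alpha>\<close> would be parallel to \<open>b\<close>.\<close>

lemma pos_reflection_simple: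
  assumes "\<alpha> \<in> \<Phi>0" "b \<in> \<Delta>0" "\<alpha> \<noteq> b" "\<alpha> \<noteq> - b" "pos \<alpha>"
  shows "pos (reflection (\<bullet>) b \<alpha>)"
proof (rule ccontr)
  let ?s = "reflection (\<bullet>) b \<alpha>"
  have b: "b \<in> \<Phi>0" using assms simple_subset by auto
  assume "\<not> pos ?s"
  then have "pos (- ?s)" using pos_or_neg reflection_root assms b by blast
  then have "coef \<alpha> c = 0" if "c \<in> \<Delta>0" "c \<noteq> b" for c
    using that assms by (force simp: nonneg_span_iff reflection_def coef_simple)
  then have "\<alpha> = (\<Sum>c\<in>\<Delta>0. if c = b then coef \<alpha> b *\<^sub>R b else 0)"
    by (subst coef_expansion[of \<alpha>]) (auto intro!: sum.cong)
  then have "\<alpha> = coef \<alpha> b *\<^sub>R b" using finite_simple assms by simp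
  then show False using not_parallel[OF assms(1) b] assms by blast
qed

lemma pos_reflection_simple_iff:
  assumes "\<alpha> \<in> \<Phi>0" "b \<in> \<Delta>0" "\<alpha> \<noteq> b" "\<alpha> \<noteq> - b"
  shows "pos (reflection (\<bullet>) b \<alpha>) \<longleftrightarrow> pos \<alpha>"
proof -
  have b: "b \<in> \<Phi>0" using assms simple_subset by auto
  have "pos (reflection (\<bullet>) b (- \<alpha>))" if "\<not> pos \<alpha>"
    using that assms pos_uminus uminus_root by (intro pos_reflection_simple) auto
  moreover have "reflection (\<bullet>) b (- \<alpha>) = - reflection (\<bullet>) b \<alpha>"
    by (simp add: reflection_def)
  ultimately show ?thesis
    using pos_reflection_simple[OF assms] not_pos_and_neg reflection_root[OF b assms(1)] by auto
qed

section \<open>Weights and the level function\<close>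

text \<open>
  On roots of square length \<open>L\<close> this is the height when the roots are short, and the height of
  the coroot when they are long.
\<close>

definition weight :: "real \<Rightarrow> 'a \<Rightarrow> real" where
  "weight L v = (\<Sum>b\<in>\<Delta>0. coef v b * min 1 ((b \<bullet> b) / L))"

lemma weight_simps [simp]:
  "weight L (u + v) = weight L u + weight L v" "weight L (u - v) = weight L u - weight L v"
  "weight L (- v) = - weight L v" "weight L (r *\<^sub>R v) = r * weight L v"
  by (simp_all add: weight_def sum.distrib sum_subtractf sum_negf sum_distrib_left algebra_simps)

lemma weight_simple: "b \<in> \<Delta>0 \<Longrightarrow> weight L b = min 1 ((b \<bullet> b) / L)"
  using finite_simple by (simp add: weight_def coef_simple if_distrib[of "\<lambda>x. x * _"] cong: if_cong)

lemma weight_nonneg: "L > 0 \<Longrightarrow> pos v \<Longrightarrow> weight L v \<ge> 0"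
  unfolding weight_def by (intro sum_nonneg mult_nonneg_nonneg) (auto simp: nonneg_span_iff)

text \<open>
  Of the Cartan integers of \<open>\<alpha>\<close> and \<open>b\<close> the one divided by the larger square length is \<open>1\<close>; the
  minimum in the weight selects it.
\<close>

lemma weight_reflection_simple:
  assumes "\<alpha> \<in> \<Phi>0" "b \<in> \<Delta>0" "\<alpha> \<noteq> b" "\<alpha> \<bullet> b > 0"
  shows "weight (\<alpha> \<bullet> \<alpha>) (reflection (\<bullet>) b \<alpha>) = weight (\<alpha> \<bullet> \<alpha>) \<alpha> - 1"
proof -
  have b: "b \<in> \<Phi>0" using assms simple_subset by auto
  have p: "\<alpha> \<bullet> \<alpha> > 0" "b \<bullet> b > 0" using root_inner_pos b assms by auto
  have "2 * (\<alpha> \<bullet> b) / (b \<bullet> b) * min 1 ((b \<bullet> b) / (\<alpha> \<bullet> \<alpha>)) = 1"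
  proof (cases "\<alpha> \<bullet> \<alpha> \<le> b \<bullet> b")
    case True
    then show ?thesis using cartan_eq_1[of \<alpha> b] assms b p by (simp add: min_def)
  next
    case False
    then have "2 * (b \<bullet> \<alpha>) / (\<alpha> \<bullet> \<alpha>) = 1"
      using cartan_eq_1[of b \<alpha>] assms b by (simp add: inner_commute)
    moreover have "min 1 ((b \<bullet> b) / (\<alpha> \<bullet> \<alpha>)) = (b \<bullet> b) / (\<alpha> \<bullet> \<alpha>)"
      using False p by (intro min.absorb2) simp
    ultimately show ?thesis using p by (simp add: inner_commute)
  qed
  then show ?thesis using assms by (simp add: reflection_def weight_simple)
qed

text \<open>The weight depends on the root only through its square length, which reflections
  preserve, so one linear functional serves along a whole word. Negative affine roots, through which
  a word may pass, get a value too.\<close>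

definition level :: "'a \<times> real \<Rightarrow> real" where
  "level \<beta> = (let \<alpha> = fst \<beta>; L = \<alpha> \<bullet> \<alpha> in
     snd \<beta> * weight L \<omega> + weight L \<alpha> - (if pos \<alpha> then 1 else 0))"

abbreviation simples :: "('a \<times> real) set" where
  "simples \<equiv> affine_simple_roots \<Delta>0 \<omega>"

abbreviation refl :: "'a \<times> real \<Rightarrow> 'a \<times> real \<Rightarrow> 'a \<times> real" where
  "refl \<equiv> reflection affine_form"

lemma refl_emb: "refl (emb b) (\<alpha>, x) = (reflection (\<bullet>) b \<alpha>, x)"
  by (simp add: reflection_def affine_form_def emb_def)

lemma refl_delta:
  "refl (delta - emb \<omega>) (\<alpha>, x) = (reflection (\<bullet>) \<omega> \<alpha>, x + 2 * (\<alpha> \<bullet> \<omega>) / (\<omega> \<bullet> \<omega>))"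
  by (simp add: reflection_def affine_form_def emb_def delta_def)

lemma simples_cases:
  assumes "\<gamma> \<in> simples"
  obtains b where "b \<in> \<Delta>0" "\<gamma> = emb b" | "\<gamma> = delta - emb \<omega>"
  using assms by (auto simp: affine_simple_roots_def)

lemma fst_simple: "\<gamma> \<in> simples \<Longrightarrow> fst \<gamma> \<in> \<Phi>0"
  using simple_subset highest_mem uminus_root
  by (auto simp: affine_simple_roots_def emb_def delta_def)

lemma fst_refl: "\<gamma> \<in> simples \<Longrightarrow> fst \<beta> \<in> \<Phi>0 \<Longrightarrow> fst (refl \<gamma> \<beta>) \<in> \<Phi>0"
  using reflection_root[OF fst_simple, of \<gamma> "fst \<beta>"]
  by (simp add: reflection_def affine_form_def)

text \<open>For a finite simple \<open>b\<close> other than \<open>\<alpha>\<close> the sign of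
  \<open>\<alpha>\<close> is kept and the weight drops by one; if \<open>\<alpha> = b\<close> the
  weight drops by two and losing the sign term gives one back. For
  \<open>delta - emb \<omega>\<close> the linear part is unchanged, as it vanishes on that root, and
  only the sign term appears.\<close>

lemma level_refl_pos:
  assumes "fst \<beta> \<in> \<Phi>0" "\<gamma> \<in> simples" "affine_form \<beta> \<gamma> > 0"
  shows "level (refl \<gamma> \<beta>) = level \<beta> - 1"
proof -
  obtain \<alpha> x where \<beta>: "\<beta> = (\<alpha>, x)" by (cases \<beta>)
  have \<alpha>: "\<alpha> \<in> \<Phi>0" using assms \<beta> by simp
  from assms(2) show ?thesis
  proof (cases rule: simples_cases)
    case (1 b)
    then have b: "b \<in> \<Phi>0" and ab: "\<alpha> \<bullet> b > 0"
      using simple_subset assms \<beta> by (auto simp: affine_form_def emb_def)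
    show ?thesis
    proof (cases "\<alpha> = b")
      case True
      then show ?thesis using 1 b root_inner_pos[OF b] pos_simple[of b] not_pos_and_neg[OF b]
        by (simp add: \<beta> refl_emb reflection_self level_def Let_def weight_simple)
    next
      case False
      moreover have "\<alpha> \<noteq> - b" using ab root_inner_pos[OF b] by auto
      ultimately show ?thesis
        using 1 weight_reflection_simple[OF \<alpha> 1(1) False ab] pos_reflection_simple_iff[OF \<alpha> 1(1)]
        by (simp add: \<beta> refl_emb level_def Let_def inner_reflection[OF b])
    qed
  next
    case 2
    have neg: "\<alpha> \<bullet> \<omega> < 0" using assms 2 \<beta> by (simp add: affine_form_def emb_def delta_def)
    have "\<not> pos \<alpha>" using pos_inner_highest neg by force
    moreover have "pos (reflection (\<bullet>) \<omega> \<alpha>)"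
      using neg \<alpha> highest_mem inner_reflection_self[OF highest_mem, of \<alpha>] reflection_root
      by (intro pos_of_inner_highest) auto
    moreover have "weight L (reflection (\<bullet>) \<omega> \<alpha>)
        = weight L \<alpha> - 2 * (\<alpha> \<bullet> \<omega>) / (\<omega> \<bullet> \<omega>) * weight L \<omega>" for L
      by (simp add: reflection_def)
    ultimately show ?thesis
      by (simp add: \<beta> 2 refl_delta level_def Let_def inner_reflection[OF highest_mem] algebra_simps)
  qed
qed

text \<open>When the form is negative, the previous lemma applies to the reflected root, because
  reflections are involutions.\<close>

lemma level_refl:
  assumes "fst \<beta> \<in> \<Phi>0" "\<gamma> \<in> simples"
  shows "level \<beta> \<le> level (refl \<gamma> \<beta>) + 1"
proof -
  have nz: "affine_form \<gamma> \<gamma> \<noteq> 0" using fst_simple[OF assms(2)] root_inner_pos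
    by (force simp: affine_form_def)
  have form: "affine_form (refl \<gamma> \<beta>) \<gamma> = - affine_form \<beta> \<gamma>"
    using nz by (simp add: reflection_def affine_form_def inner_diff_left)
  then have invol: "refl \<gamma> (refl \<gamma> \<beta>) = \<beta>" unfolding reflection_def by simp
  consider "affine_form \<beta> \<gamma> > 0" | "affine_form \<beta> \<gamma> = 0" | "affine_form \<beta> \<gamma> < 0" by linarith
  then show ?thesis
  proof cases
    case 2
    then show ?thesis by (simp add: reflection_def)
  next
    case 3
    then show ?thesis
      using level_refl_pos[of "refl \<gamma> \<beta>" \<gamma>] form invol fst_refl[OF assms(2,1)] assms by simp
  qed (use level_refl_pos assms in simp)
qed

lemma level_simple: "\<gamma> \<in> simples \<Longrightarrow> level \<gamma> = 0"
proof (erule simples_cases)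
  fix b assume "b \<in> \<Delta>0" "\<gamma> = emb b"
  then show ?thesis using root_inner_pos[of b] simple_subset pos_simple[of b]
    by (auto simp: level_def emb_def Let_def weight_simple)
next
  assume "\<gamma> = delta - emb \<omega>"
  then show ?thesis using not_pos_and_neg[OF highest_mem pos_highest]
    by (simp add: level_def emb_def delta_def Let_def)
qed

abbreviation gens :: "('a \<times> real \<Rightarrow> 'a \<times> real) set" where
  "gens \<equiv> affine_simple_reflections \<Delta>0 \<omega>"

lemma word_prod_simps: "word_prod [] = id" "word_prod (s # ws) = s \<circ> word_prod ws"
  "word_prod (us @ ws) = word_prod us \<circ> word_prod ws"
  by (induction us) (auto simp: word_prod_def)

text \<open>Each letter lowers the level by at most one. As the level is 0 on simple roots, this
  bounds the depth from below.\<close>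

lemma level_le_word:
  assumes "fst \<beta> \<in> \<Phi>0" "set ws \<subseteq> gens"
  shows "fst (word_prod ws \<beta>) \<in> \<Phi>0 \<and> level \<beta> \<le> level (word_prod ws \<beta>) + length ws"
  using assms(2)
proof (induction ws)
  case Nil
  then show ?case using assms(1) by (simp add: word_prod_simps)
next
  case (Cons s ws)
  then obtain \<gamma> where "\<gamma> \<in> simples" "s = refl \<gamma>" by (auto simp: affine_simple_reflections_def)
  then show ?case
    using Cons fst_refl[of \<gamma> "word_prod ws \<beta>"] level_refl[of "word_prod ws \<beta>" \<gamma>]
    by (auto simp: word_prod_simps)
qed

section \<open>Descent of positive affine roots to simple roots\<close>

abbreviation pos_roots :: "('a \<times> real) set" where
  "pos_roots \<equiv> affine_positive_roots \<Phi>0 \<Delta>0"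

lemma pos_roots_iff:
  "(\<alpha>, x) \<in> pos_roots \<longleftrightarrow> \<alpha> \<in> \<Phi>0 \<and> (\<exists>k::nat. x = real k \<and> (pos \<alpha> \<or> k > 0))" (is "?l \<longleftrightarrow> ?r")
proof
  assume ?l
  then show ?r
    using uminus_root
    by (auto simp: affine_positive_roots_def positive_roots_def delta_def emb_def
        intro: exI[of _ "Suc k" for k])
next
  assume ?r
  then obtain k :: nat where k: "\<alpha> \<in> \<Phi>0" "x = real k" "pos \<alpha> \<or> k > 0" by blast
  show ?l
  proof (cases "pos \<alpha>")
    case True
    then show ?thesis using k
      by (auto simp: affine_positive_roots_def positive_roots_def delta_def emb_def)
  next
    case False
    then obtain j where "k = j + 1" using k by (metis Suc_eq_plus1 gr0_implies_Suc)
    moreover have "- \<alpha> \<in> positive_roots \<Phi>0 \<Delta>0"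
      using k(1) False uminus_root pos_uminus by (simp add: positive_roots_def)
    ultimately have "(\<alpha>, x) = real (j + 1) *\<^sub>R delta - emb (- \<alpha>)"
      using k by (simp add: delta_def emb_def)
    then show ?thesis using \<open>- \<alpha> \<in> positive_roots \<Phi>0 \<Delta>0\<close>
      unfolding affine_positive_roots_def by blast
  qed
qed

lemma fst_pos_roots: "\<beta> \<in> pos_roots \<Longrightarrow> fst \<beta> \<in> \<Phi>0"
  using pos_roots_iff by (cases \<beta>) auto

lemma weight_highest_ge: "\<alpha> \<in> \<Phi>0 \<Longrightarrow> L > 0 \<Longrightarrow> weight L \<alpha> \<le> weight L \<omega>"
  using weight_nonneg[of L "\<omega> - \<alpha>"] highest_diff by simp

text \<open>A crude bound that serves to end the descent in \<open>word_of_level\<close>.\<close>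

lemma level_ge: "\<beta> \<in> pos_roots \<Longrightarrow> level \<beta> \<ge> - 1"
proof -
  assume \<beta>: "\<beta> \<in> pos_roots"
  obtain \<alpha> x where \<beta>': "\<beta> = (\<alpha>, x)" by (cases \<beta>)
  then obtain k :: nat where k: "\<alpha> \<in> \<Phi>0" "x = real k" "pos \<alpha> \<or> k > 0"
    using \<beta> pos_roots_iff by blast
  let ?w = "weight (\<alpha> \<bullet> \<alpha>)"
  have L: "\<alpha> \<bullet> \<alpha> > 0" using root_inner_pos k by simp
  have w: "?w \<omega> \<ge> 0" using weight_nonneg L pos_highest by blast
  show ?thesis
  proof (cases "pos \<alpha>")
    case True
    then show ?thesis using weight_nonneg[OF L True] w k
      by (simp add: \<beta>' level_def Let_def)
  next
    case False
    then have "real k \<ge> 1" using k by auto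
    then have "real k * ?w \<omega> \<ge> ?w \<omega>" using w by (simp add: mult_le_cancel_right1)
    then show ?thesis using weight_highest_ge[OF uminus_root[OF k(1)] L] k False
      by (simp add: \<beta>' level_def Let_def)
  qed
qed

lemma simple_inner_pos:
  assumes "\<alpha> \<in> \<Phi>0" "pos \<alpha>"
  obtains b where "b \<in> \<Delta>0" "\<alpha> \<bullet> b > 0"
proof -
  have "\<exists>b\<in>\<Delta>0. \<alpha> \<bullet> b > 0"
  proof (rule ccontr)
    assume *: "\<not> ?thesis"
    have "\<alpha> \<bullet> (- \<alpha>) \<ge> 0"
      by (rule inner_nonneg_of_dominant)
        (use * assms in \<open>auto simp: inner_commute[of _ \<alpha>] not_less\<close>)
    then show False using root_inner_pos[OF assms(1)] by simp
  qed
  then show ?thesis using that by blast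
qed

text \<open>If no finite simple root works, \<open>- \<alpha>\<close> is dominant; pairing it with
  \<open>\<omega> - (- \<alpha>)\<close> gives \<open>\<alpha> \<bullet> \<omega> \<le> - (\<alpha>
  \<bullet> \<alpha>) < 0\<close>, so \<open>delta - emb \<omega>\<close> works.\<close>

lemma affine_simple_form_pos:
  assumes "\<beta> \<in> pos_roots"
  obtains \<gamma> where "\<gamma> \<in> simples" "affine_form \<beta> \<gamma> > 0"
proof -
  obtain \<alpha> x where \<beta>: "\<beta> = (\<alpha>, x)" by (cases \<beta>)
  have \<alpha>: "\<alpha> \<in> \<Phi>0" using assms \<beta> pos_roots_iff by auto
  have "\<exists>\<gamma>\<in>simples. affine_form \<beta> \<gamma> > 0"
  proof (cases "\<exists>b\<in>\<Delta>0. \<alpha> \<bullet> b > 0")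
    case True
    then show ?thesis by (auto simp: \<beta> affine_simple_roots_def affine_form_def emb_def)
  next
    case False
    then have neg: "\<not> pos \<alpha>" using simple_inner_pos \<alpha> by metis
    have "(\<omega> - (- \<alpha>)) \<bullet> (- \<alpha>) \<ge> 0"
      by (rule inner_nonneg_of_dominant)
        (use False highest_diff[OF uminus_root[OF \<alpha>]] in \<open>auto simp: inner_commute[of _ \<alpha>] not_less\<close>)
    then have "\<alpha> \<bullet> \<alpha> \<le> - (\<alpha> \<bullet> \<omega>)" by (simp add: inner_add_left inner_commute[of \<omega>])
    then have "\<alpha> \<bullet> \<omega> < 0" using root_inner_pos[OF \<alpha>] by linarith
    then show ?thesis
      by (auto simp: \<beta> affine_simple_roots_def affine_form_def emb_def delta_def)
  qed
  then show ?thesis using that by blast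
qed

lemma refl_pos_roots:
  assumes "\<beta> \<in> pos_roots" "\<gamma> \<in> simples" "affine_form \<beta> \<gamma> > 0" "\<beta> \<noteq> \<gamma>"
  shows "refl \<gamma> \<beta> \<in> pos_roots"
proof -
  obtain \<alpha> x where \<beta>: "\<beta> = (\<alpha>, x)" by (cases \<beta>)
  then obtain k :: nat where k: "\<alpha> \<in> \<Phi>0" "x = real k" "pos \<alpha> \<or> k > 0"
    using assms pos_roots_iff by blast
  from assms(2) show ?thesis
  proof (cases rule: simples_cases)
    case (1 b)
    then have b: "b \<in> \<Phi>0" and ab: "\<alpha> \<bullet> b > 0"
      using simple_subset assms \<beta> by (auto simp: affine_form_def emb_def)
    have "\<alpha> \<noteq> - b" using ab root_inner_pos[OF b] by auto
    then have "pos (reflection (\<bullet>) b \<alpha>) \<or> k > 0"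
      using pos_reflection_simple[OF k(1) 1(1)] k assms(4) 1(2) \<beta> by (auto simp: emb_def)
    then show ?thesis using k reflection_root[OF b] by (auto simp: \<beta> 1 refl_emb pos_roots_iff)
  next
    case 2
    have neg: "\<alpha> \<bullet> \<omega> < 0" using assms 2 \<beta> by (simp add: affine_form_def emb_def delta_def)
    then have "\<not> pos \<alpha>" using pos_inner_highest by force
    then have k0: "k > 0" using k by simp
    let ?s = "reflection (\<bullet>) \<omega> \<alpha>"
    have s: "?s \<in> \<Phi>0" "pos ?s"
      using neg k highest_mem inner_reflection_self[OF highest_mem, of \<alpha>] reflection_root
      by (auto intro: pos_of_inner_highest)
    \<comment> \<open>The finite part is now positive, so any natural coefficient will do. It falls
      by 1, as \<open>\<omega>\<close> is longest, except that it falls by 2 for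
      \<open>\<alpha> = - \<omega>\<close>; there \<open>k = 1\<close> would make
      \<open>\<beta>\<close> the simple root itself.\<close>
    have "\<exists>j::nat. real k + 2 * (\<alpha> \<bullet> \<omega>) / (\<omega> \<bullet> \<omega>) = real j"
    proof (cases "- \<alpha> = \<omega>")
      case True
      then have "\<alpha> = - \<omega>" by auto
      then have "k \<noteq> 1" "2 * (\<alpha> \<bullet> \<omega>) / (\<omega> \<bullet> \<omega>) = - 2"
        using assms(4) 2 \<beta> k root_inner_pos[OF highest_mem] by (auto simp: delta_def emb_def)
      then show ?thesis using k0 by (intro exI[of _ "k - 2"]) (auto simp: of_nat_diff)
    next
      case False
      then have "2 * (- \<alpha> \<bullet> \<omega>) / (\<omega> \<bullet> \<omega>) = 1"
        using neg k highest_longest[OF k(1)] uminus_root highest_mem by (intro cartan_eq_1) auto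
      then show ?thesis using k0 by (intro exI[of _ "k - 1"]) (auto simp: of_nat_diff)
    qed
    then show ?thesis using s by (auto simp: \<beta> 2 k refl_delta pos_roots_iff)
  qed
qed

text \<open>Greedy descent: reflect in a simple root of positive form with \<open>\<beta>\<close>,
  which costs one level, until \<open>\<beta>\<close> is itself that simple root.\<close>

lemma word_of_level:
  assumes "\<beta> \<in> pos_roots"
  shows "\<exists>ws. set ws \<subseteq> gens \<and> real (length ws) = level \<beta> \<and> word_prod ws \<beta> \<in> simples"
proof -
  \<comment> \<open>The level is real and not yet known to be an integer, so the induction runs over
    a natural upper bound.\<close>
  obtain n where "level \<beta> + 1 < real n" using reals_Archimedean2 by blast
  then show ?thesis using assms
  proof (induction n arbitrary: \<beta>)
    case 0
    then show ?case using level_ge by fastforce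
  next
    case (Suc n)
    obtain \<gamma> where \<gamma>: "\<gamma> \<in> simples" "affine_form \<beta> \<gamma> > 0"
      using affine_simple_form_pos Suc by blast
    show ?case
    proof (cases "\<beta> = \<gamma>")
      case True
      then show ?thesis using \<gamma> level_simple by (intro exI[of _ "[]"]) (simp add: word_prod_simps)
    next
      case False
      have lev: "level (refl \<gamma> \<beta>) = level \<beta> - 1"
        using level_refl_pos \<gamma> Suc fst_pos_roots by blast
      then obtain ws where "set ws \<subseteq> gens" "real (length ws) = level \<beta> - 1"
        "word_prod ws (refl \<gamma> \<beta>) \<in> simples"
        using Suc.IH[of "refl \<gamma> \<beta>"] Suc.prems refl_pos_roots[OF _ \<gamma> False] by auto
      then show ?thesis using \<gamma>
        \<comment> \<open>\<open>word_prod\<close> applies the last letter first.\<close>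
        by (intro exI[of _ "ws @ [refl \<gamma>]"])
          (auto simp: word_prod_simps affine_simple_reflections_def)
    qed
  qed
qed

lemma depth_eq_level:
  assumes "\<beta> \<in> pos_roots"
  shows "real (depth \<Delta>0 \<omega> \<beta>) = level \<beta>"
proof -
  obtain ws where ws: "set ws \<subseteq> gens" "real (length ws) = level \<beta>" "word_prod ws \<beta> \<in> simples"
    using word_of_level[OF assms] by blast
  have lower: "length ws \<le> affine_length \<Delta>0 \<omega> w"
    if w: "w \<in> affine_weyl_group \<Delta>0 \<omega>" "w \<beta> \<in> simples" for w
  proof -
    have "\<exists>n us. set us \<subseteq> gens \<and> length us = n \<and> word_prod us = w"
      using w(1) unfolding affine_weyl_group_def generated_by_def by blast
    then have "\<exists>us. set us \<subseteq> gens \<and> length us = affine_length \<Delta>0 \<omega> w \<and> word_prod us = w"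
      unfolding affine_length_def word_length_def by (rule LeastI_ex)
    then obtain us where us: "set us \<subseteq> gens" "length us = affine_length \<Delta>0 \<omega> w" "word_prod us = w"
      by blast
    then have "level \<beta> \<le> level (w \<beta>) + length us"
      using level_le_word fst_pos_roots[OF assms] by blast
    then show ?thesis using ws us level_simple[OF w(2)] by simp
  qed
  let ?w = "word_prod ws"
  have mem: "?w \<in> affine_weyl_group \<Delta>0 \<omega>"
    using ws unfolding affine_weyl_group_def generated_by_def by blast
  \<comment> \<open>The depth minimises the length of group elements, so \<open>ws\<close> has to be
    a reduced word; the lower bound applied to \<open>?w\<close> itself shows this.\<close>
  have "affine_length \<Delta>0 \<omega> ?w \<le> length ws"
    unfolding affine_length_def word_length_def by (rule Least_le) (use ws in blast)
  then have "affine_length \<Delta>0 \<omega> ?w = length ws" using lower[OF mem ws(3)] by simp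
  then have "depth \<Delta>0 \<omega> \<beta> = length ws"
    unfolding depth_def using mem ws(3) lower by (intro Least_equality) blast+
  then show ?thesis using ws by simp
qed

section \<open>Counting roots of a given depth\<close>

text \<open>
  The positive affine roots with finite part \<open>\<alpha>\<close> are \<open>\<alpha> + (j + shift \<alpha>) \<delta>\<close> for \<open>j \<in> \<nat>\<close>; those with
  \<open>j = 0\<close> make up the union of the sets \<open>\<Sigma>\<close>.
\<close>

definition shift :: "'a \<Rightarrow> nat" where
  "shift \<alpha> = (if pos \<alpha> then 0 else 1)"

lemma shift_pos_roots: "\<alpha> \<in> \<Phi>0 \<Longrightarrow> (\<alpha>, real (j + shift \<alpha>)) \<in> pos_roots"
  unfolding pos_roots_iff shift_def by (intro conjI exI[of _ "j + (if pos \<alpha> then 0 else 1)"]) auto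

definition base_depth :: "'a \<Rightarrow> nat" where
  "base_depth \<alpha> = depth \<Delta>0 \<omega> (\<alpha>, real (shift \<alpha>))"

text \<open>In this form it is visibly a positive natural number, larger than
  \<open>base_depth \<alpha>\<close> and invariant under negation.\<close>

definition step :: "'a \<Rightarrow> nat" where
  "step \<alpha> = base_depth \<alpha> + base_depth (- \<alpha>) + 1"

lemma base_depth_eq:
  "\<alpha> \<in> \<Phi>0 \<Longrightarrow> real (base_depth \<alpha>) =
     (if pos \<alpha> then weight (\<alpha> \<bullet> \<alpha>) \<alpha> - 1 else weight (\<alpha> \<bullet> \<alpha>) \<omega> + weight (\<alpha> \<bullet> \<alpha>) \<alpha>)"
  unfolding base_depth_def
  by (subst depth_eq_level) (auto simp: pos_roots_iff shift_def level_def Let_def)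

text \<open>The weights of \<open>\<alpha>\<close> and \<open>- \<alpha>\<close> cancel, and exactly
  one of the two is positive, so the \<open>- 1\<close> occurs once. Hence \<open>step\<close>
  depends only on the square length.\<close>

lemma step_eq: "\<alpha> \<in> \<Phi>0 \<Longrightarrow> real (step \<alpha>) = weight (\<alpha> \<bullet> \<alpha>) \<omega>"
  using base_depth_eq[of \<alpha>] base_depth_eq[of "- \<alpha>"] uminus_root[of \<alpha>] pos_uminus[of \<alpha>]
  unfolding step_def by auto

lemma depth_shift:
  assumes "\<alpha> \<in> \<Phi>0"
  shows "depth \<Delta>0 \<omega> (\<alpha>, real (j + shift \<alpha>)) = j * step \<alpha> + base_depth \<alpha>"
proof -
  have "real (depth \<Delta>0 \<omega> (\<alpha>, real (j + shift \<alpha>))) = level (\<alpha>, real (j + shift \<alpha>))"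
    using assms by (intro depth_eq_level shift_pos_roots)
  also have "\<dots> = real j * real (step \<alpha>) + real (base_depth \<alpha>)"
    using assms by (simp add: level_def Let_def step_eq base_depth_eq shift_def algebra_simps)
  also have "\<dots> = real (j * step \<alpha> + base_depth \<alpha>)" by simp
  finally show ?thesis by linarith
qed

text \<open>As \<open>base_depth \<alpha> < step \<alpha>\<close>, \<open>depth_shift\<close> is a
  division with remainder: each finite part has at most one root of depth \<open>n\<close>, with the
  quotient as its coefficient of \<open>delta\<close> up to \<open>shift\<close>.\<close>

lemma roots_of_depth_eq:
  "roots_of_depth \<Phi>0 \<Delta>0 \<omega> n =
     (\<lambda>\<alpha>. (\<alpha>, real (n div step \<alpha> + shift \<alpha>))) ` {\<alpha> \<in> \<Phi>0. n mod step \<alpha> = base_depth \<alpha>}"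
    (is "?l = ?r")
proof
  show "?l \<subseteq> ?r"
  proof
    fix \<beta> assume \<beta>: "\<beta> \<in> ?l"
    obtain \<alpha> x where \<beta>': "\<beta> = (\<alpha>, x)" by (cases \<beta>)
    then obtain k :: nat where k: "\<alpha> \<in> \<Phi>0" "x = real k" "pos \<alpha> \<or> k > 0"
      using \<beta> pos_roots_iff by (auto simp: roots_of_depth_def)
    then obtain j where j: "x = real (j + shift \<alpha>)"
      by (cases "pos \<alpha>") (auto simp: shift_def gr0_conv_Suc)
    then have n: "n = j * step \<alpha> + base_depth \<alpha>"
      using \<beta> \<beta>' depth_shift[OF k(1)] by (simp add: roots_of_depth_def)
    have "base_depth \<alpha> < step \<alpha>" by (simp add: step_def)
    then have "n div step \<alpha> = j" "n mod step \<alpha> = base_depth \<alpha>" unfolding n by simp_all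
    then show "\<beta> \<in> ?r" using k j \<beta>' by auto
  qed
  show "?r \<subseteq> ?l"
  proof clarify
    fix \<alpha> assume \<alpha>: "\<alpha> \<in> \<Phi>0" "n mod step \<alpha> = base_depth \<alpha>"
    have "depth \<Delta>0 \<omega> (\<alpha>, real (n div step \<alpha> + shift \<alpha>)) = n"
      using depth_shift[OF \<alpha>(1), of "n div step \<alpha>"] \<alpha>(2) by (metis div_mult_mod_eq)
    moreover have "(\<alpha>, real (n div step \<alpha> + shift \<alpha>)) \<in> pos_roots"
      using \<alpha>(1) by (rule shift_pos_roots)
    ultimately show "(\<alpha>, real (n div step \<alpha> + shift \<alpha>)) \<in> ?l"
      unfolding roots_of_depth_def by blast
  qed
qed

lemma finite_roots_of_depth: "finite (roots_of_depth \<Phi>0 \<Delta>0 \<omega> n)"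
  using finite_roots by (simp add: roots_of_depth_eq)

lemma card_roots_of_depth:
  "card (roots_of_depth \<Phi>0 \<Delta>0 \<omega> n) = card {\<alpha> \<in> \<Phi>0. n mod step \<alpha> = base_depth \<alpha>}"
  unfolding roots_of_depth_eq by (intro card_image inj_onI) auto

section \<open>Orbits and the period\<close>

text \<open>The same greedy descent inside the finite group, with the weight as its measure.\<close>

lemma conjugate_to_simple:
  assumes "\<alpha> \<in> \<Phi>0" "pos \<alpha>"
  shows "\<exists>w \<in> finite_weyl_group \<Delta>0. w \<alpha> \<in> \<Delta>0"
proof -
  have "\<exists>ws. set ws \<subseteq> reflection (\<bullet>) ` \<Delta>0 \<and> word_prod ws \<alpha> \<in> \<Delta>0"
  proof -
    obtain n where "weight (\<alpha> \<bullet> \<alpha>) \<alpha> < real n" using reals_Archimedean2 by blast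
    then show ?thesis using assms
    proof (induction n arbitrary: \<alpha>)
      case 0
      then show ?case using weight_nonneg[OF root_inner_pos, of \<alpha> \<alpha>] by simp
    next
      case (Suc n)
      obtain b where b: "b \<in> \<Delta>0" "\<alpha> \<bullet> b > 0" using simple_inner_pos Suc by blast
      have b': "b \<in> \<Phi>0" using b simple_subset by auto
      show ?case
      proof (cases "\<alpha> = b")
        case True
        then show ?thesis using b by (intro exI[of _ "[]"]) (simp add: word_prod_simps)
      next
        case False
        let ?s = "reflection (\<bullet>) b \<alpha>"
        have "\<alpha> \<noteq> - b" using b root_inner_pos[OF b'] by auto
        then have "pos ?s" using pos_reflection_simple Suc.prems b False by blast
        moreover have "weight (?s \<bullet> ?s) ?s < real n"
          using weight_reflection_simple[OF Suc.prems(2) b(1) False b(2)] Suc.prems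
          by (simp add: inner_reflection[OF b'])
        ultimately obtain ws where "set ws \<subseteq> reflection (\<bullet>) ` \<Delta>0" "word_prod ws ?s \<in> \<Delta>0"
          using Suc.IH[of ?s] reflection_root[OF b' Suc.prems(2)] by blast
        then show ?thesis using b
          by (intro exI[of _ "ws @ [reflection (\<bullet>) b]"]) (auto simp: word_prod_simps)
      qed
    qed
  qed
  then show ?thesis unfolding finite_weyl_group_def generated_by_def by blast
qed

text \<open>Makes the square length, and with it \<open>step\<close>, constant on orbits.\<close>

lemma finite_weyl_group_isometry:
  assumes "w \<in> finite_weyl_group \<Delta>0"
  shows "w v \<bullet> w v = v \<bullet> v"
proof -
  obtain ws where ws: "w = word_prod ws" "set ws \<subseteq> reflection (\<bullet>) ` \<Delta>0"
    using assms by (auto simp: finite_weyl_group_def generated_by_def)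
  have "word_prod ws v \<bullet> word_prod ws v = v \<bullet> v" using ws(2)
    by (induction ws) (use simple_subset inner_reflection in \<open>auto simp: word_prod_simps\<close>)
  then show ?thesis using ws by simp
qed

lemma base_depth_simple: "b \<in> \<Delta>0 \<Longrightarrow> base_depth b = 0"
  using base_depth_eq[of b] simple_subset pos_simple[of b] root_inner_pos[of b]
  by (auto simp: weight_simple)

text \<open>The depths in question are \<open>base_depth\<close> at plus and minus the positive
  orbit elements, each at most \<open>step \<alpha> - 1\<close>. Equality holds at
  \<open>delta - emb b\<close> for a simple root \<open>b\<close> of the orbit, since
  \<open>base_depth b = 0\<close>.\<close>

lemma max_depth_orbit:
  assumes "\<alpha> \<in> \<Phi>0" "pos \<alpha>"
  shows "max_depth \<Phi>0 \<Delta>0 \<omega> {w \<alpha> | w. w \<in> finite_weyl_group \<Delta>0} + 1 = step \<alpha>"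
proof -
  let ?O = "{w \<alpha> | w. w \<in> finite_weyl_group \<Delta>0}"
  let ?Q = "?O \<inter> positive_roots \<Phi>0 \<Delta>0"
  have step: "step \<gamma> = step \<alpha>" if "\<gamma> \<in> ?Q" for \<gamma>
  proof -
    have "\<gamma> \<bullet> \<gamma> = \<alpha> \<bullet> \<alpha>" "\<gamma> \<in> \<Phi>0"
      using that finite_weyl_group_isometry by (auto simp: positive_roots_def)
    then have "real (step \<gamma>) = real (step \<alpha>)" using assms by (simp add: step_eq)
    then show ?thesis by simp
  qed
  have shift: "shift \<gamma> = 0" "shift (- \<gamma>) = 1" if "\<gamma> \<in> ?Q" for \<gamma>
    using that not_pos_and_neg[of \<gamma>] by (auto simp: shift_def positive_roots_def)
  have "depth \<Delta>0 \<omega> ` Sigma_orbit \<Phi>0 \<Delta>0 ?O = base_depth ` ?Q \<union> (\<lambda>\<gamma>. base_depth (- \<gamma>)) ` ?Q"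
    unfolding Sigma_orbit_def image_Un image_image base_depth_def
    by (intro arg_cong2[of _ _ _ _ "(\<union>)"] image_cong) (simp_all add: shift emb_def delta_def)
  moreover have "Max (base_depth ` ?Q \<union> (\<lambda>\<gamma>. base_depth (- \<gamma>)) ` ?Q) = step \<alpha> - 1"
  proof (rule Max_eqI)
    have "finite ?Q" using finite_roots by (simp add: positive_roots_def)
    then show "finite (base_depth ` ?Q \<union> (\<lambda>\<gamma>. base_depth (- \<gamma>)) ` ?Q)" by blast
    have "base_depth \<gamma> \<le> step \<alpha> - 1 \<and> base_depth (- \<gamma>) \<le> step \<alpha> - 1" if "\<gamma> \<in> ?Q" for \<gamma>
      using step[OF that] by (auto simp: step_def)
    then show "y \<le> step \<alpha> - 1" if "y \<in> base_depth ` ?Q \<union> (\<lambda>\<gamma>. base_depth (- \<gamma>)) ` ?Q" for y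
      using that by blast
    obtain w where w: "w \<in> finite_weyl_group \<Delta>0" "w \<alpha> \<in> \<Delta>0"
      using conjugate_to_simple[OF assms] by blast
    then have Q: "w \<alpha> \<in> ?Q" using simple_subset pos_simple by (auto simp: positive_roots_def)
    have "step \<alpha> - 1 = base_depth (- w \<alpha>)"
      using step[OF Q] base_depth_simple[OF w(2)] by (simp add: step_def)
    then show "step \<alpha> - 1 \<in> base_depth ` ?Q \<union> (\<lambda>\<gamma>. base_depth (- \<gamma>)) ` ?Q" using Q by blast
  qed
  ultimately show ?thesis by (simp add: max_depth_def step_def)
qed

lemma step_uminus: "step (- \<alpha>) = step \<alpha>"
  by (simp add: step_def)

lemma step_dvd_period: "\<alpha> \<in> \<Phi>0 \<Longrightarrow> step \<alpha> dvd period \<Phi>0 \<Delta>0 \<omega>"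
proof -
  have *: "step \<alpha> dvd period \<Phi>0 \<Delta>0 \<omega>" if "\<alpha> \<in> \<Phi>0" "pos \<alpha>" for \<alpha>
    unfolding period_def max_depth_orbit[OF that, symmetric]
    by (rule dvd_Lcm) (use that in \<open>auto simp: root_orbits_def\<close>)
  show "step \<alpha> dvd period \<Phi>0 \<Delta>0 \<omega>" if "\<alpha> \<in> \<Phi>0"
    \<comment> \<open>For negative \<open>\<alpha>\<close> the orbit of \<open>- \<alpha>\<close>
      supplies the divisor, which is the same number.\<close>
    using pos_or_neg[OF that] *[OF that] *[OF uminus_root[OF that]] by (auto simp: step_uminus)
qed

text \<open>\<open>Lcm\<close> is 0 on infinite sets of naturals, hence the finiteness of the set of
  orbits; its entries here are successors.\<close>

lemma period_pos: "period \<Phi>0 \<Delta>0 \<omega> > 0"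
proof -
  have "finite (root_orbits \<Phi>0 \<Delta>0)" using finite_roots by (simp add: root_orbits_def)
  then have "period \<Phi>0 \<Delta>0 \<omega> \<noteq> 0" unfolding period_def by (subst Lcm_0_iff) auto
  then show ?thesis by simp
qed

text \<open>The progressions are indexed by the finite roots, and negation is the
  involution.\<close>

lemma depth_series_rational:
  "\<exists>P::rat poly. palindromic P \<and>
     depth_series \<Phi>0 \<Delta>0 \<omega> = fps_of_poly P / (1 - fps_X ^ period \<Phi>0 \<Delta>0 \<omega>)"
  unfolding depth_series_def card_roots_of_depth
proof (rule periodic_palindromic_series[where A = \<Phi>0 and N = step and d = base_depth and i = uminus])
  show "- \<alpha> \<in> \<Phi>0" "step \<alpha> dvd period \<Phi>0 \<Delta>0 \<omega>" if "\<alpha> \<in> \<Phi>0" for \<alpha>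
    using that uminus_root step_dvd_period by auto
  show "base_depth \<alpha> + base_depth (- \<alpha>) + 1 = step \<alpha>" for \<alpha>
    by (simp add: step_def)
  obtain b where "b \<in> \<Delta>0" using simple_inner_pos[OF highest_mem pos_highest] by blast
  then show "\<exists>\<alpha>\<in>\<Phi>0. base_depth \<alpha> = 0" using base_depth_simple simple_subset by blast
qed (simp_all add: step_uminus period_pos finite_roots)

end

theorem theorem4p11:
  fixes \<Phi>0 \<Delta>0 :: "'a::euclidean_space set" and \<omega> :: 'a
  assumes "root_system \<Phi>0" and "reduced_roots \<Phi>0" and "crystallographic \<Phi>0" and "irreducible_roots \<Phi>0"
    and "simple_system \<Phi>0 \<Delta>0" and "highest_root \<Phi>0 \<Delta>0 \<omega>"
  shows "(\<forall>n. finite (roots_of_depth \<Phi>0 \<Delta>0 \<omega> n)) \<and>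
    (\<exists>P::rat poly. palindromic P \<and>
       depth_series \<Phi>0 \<Delta>0 \<omega> = fps_of_poly P / (1 - fps_X ^ period \<Phi>0 \<Delta>0 \<omega>))"
proof -
  interpret highest_root_system \<Phi>0 \<Delta>0 \<omega>
    using assms by unfold_locales
  show ?thesis using finite_roots_of_depth depth_series_rational by blast
qed

end
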